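(* Let $G_1,\dots,G_n$ be generators over alphabets $A_1,\dots,A_n$, $L=L(\|_{i=1}^n G_i)$, organized into groups $I_1,\dots,I_m$, with alphabets $A_k,A_{k_1},\dots,A_{k_m}$ and coordinators $G_{k_1},\dots,G_{k_m}$ as in the context, and let $K\subseteq L$ be a two-level conditionally decomposable language with respect to $A_1,\dots,A_n$, $A_k$, and $A_{k_1},\dots,A_{k_m}$. For $j=1,\dots,m$ and $i\in I_j$ put $$\sup\mathrm{C}_{k_j}=\sup\mathrm{C}(P_{k_j}(K),L(G_{k_j}),A_{k_j,u}),\qquad \sup\mathrm{C}_{i+k_j}=\sup\mathrm{C}(P_{i+k_j}(K),\,L(G_i)\parallel\sup\mathrm{C}_{k_j},\,A_{i+k_j,u}).$$ Assume that for all $j=1,\dots,m$: (i) $\bigcap_{i\in I_j}P^{i+k_j}_{k_j}(\sup\mathrm{C}_{i+k_j})$ is controllable with respect to $L(G_{k_j})$ and $A_{k_j,u}$; and (ii) the projection $P^{k_j}_k:A_{k_j}^*\to A_k^*$ is an $L(G_{k_j})$-observer and OCC for $L(G_{k_j})$. Then the supremal two-level conditionally controllable sublanguage $\sup\mathrm{2cC}(K,L,A_{i+k_j})$ of $K$ satisfies $$\sup\mathrm{2cC}(K,L,A_{i+k_j})=\;\parallel_{j=1}^m\;\parallel_{i\in I_j}\sup\mathrm{C}_{i+k_j}.$$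
   Context: All languages are assumed to be prefix-closed ($L=\overline{L}$; the empty language is allowed). A generator $G=(Q,A,f,q_0)$ is a deterministic automaton with finite state set $Q$, finite alphabet $A$, partial transition function $f:Q\times A\to Q$ (extended to strings) and initial state $q_0$; its generated language is $L(G)=\{s\in A^*\mid f(q_0,s)\in Q\}$. For alphabets $B\subseteq A$, the projection $P:A^*\to B^*$ is the homomorphism erasing the letters of $A\setminus B$ and fixing those of $B$. For $L_i\subseteq A_i^*$, $i=1,\dots,n$, and $A=\bigcup_i A_i$, the synchronous product is $\|_{i=1}^n L_i=\bigcap_{i=1}^n P_i^{-1}(L_i)\subseteq A^*$, where $P_i:A^*\to A_i^*$ is the projection; the synchronous product of generators satisfies $L(\|_i G_i)=\|_i L(G_i)$. For a generator $H$ and a projection $P$, $P(H)$ is a generator with $L(P(H))=P(L(H))$. Setting: $A=\bigcup_{i=1}^n A_i$ is partitioned into controllable events $A_c$ and uncontrollable events $A_u=A\setminus A_c$. The index set $\{1,\dots,n\}$ is partitioned into groups $I_1,\dots,I_m$; $A_{I_j}=\bigcup_{i\in I_j}A_i$. An alphabet $A_k\subseteq A$ satisfies $A_k\supseteq\bigcup_{r\ne \ell}(A_{I_r}\cap A_{I_\ell})$. For $j=1,\dots,m$, the group coordinator alphabet $A_{k_j}$ satisfies $A_k\cup\bigcup_{p,q\in I_j,\,p\neq q}(A_p\cap A_q)\subseteq A_{k_j}\subseteq A_{I_j}\cup A_k$, and the group coordinator is $G_{k_j}=\|_{i=1}^n P_{k_j}(G_i)$, so that $L(G_{k_j})=\|_{i=1}^n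 P_{k_j}(L(G_i))$, where $P_{k_j}(L(G_i))$ is regarded as a language over $A_i\cap A_{k_j}$. Projections: $P_{k_j}$ projects to $A_{k_j}^*$, $P_{i+k_j}:A^*\to(A_i\cup A_{k_j})^*$, $P_{I_r+k}:A^*\to(A_{I_r}\cup A_k)^*$, and $P^{i+k_j}_{k_j}:(A_i\cup A_{k_j})^*\to A_{k_j}^*$. Also $A_{k_j,u}=A_{k_j}\cap A_u$ and $A_{i+k_j,u}=(A_i\cup A_{k_j})\cap A_u$. $K\subseteq A^*$ is two-level conditionally decomposable with respect to $A_1,\dots,A_n$, $A_k$, $A_{k_1},\dots,A_{k_m}$ if $K=\|_{r=1}^m P_{I_r+k}(K)$ and, for $r=1,\dots,m$, $P_{I_r+k}(K)=\|_{i\in I_r}P_{i+k_r}(K)$ (recall $A_k\subseteq A_{k_r}$). A language $K'$ is controllable with respect to $L'$ and $A'_u$ if $K'A'_u\cap L'\subseteq K'$. $\sup\mathrm{C}(K',L',A'_u)$ denotes the supremal controllable sublanguage of $K'$ with respect to $L'$ and $A'_u$, i.e. the largest (prefix-closed) language contained in $K'\cap L'$ that is controllable with respect to $L'$ and $A'_u$. A language $K'\subseteq L(\|_{i=1}^n G_i)$ is two-level conditionally controllable (with respect to $G_1,\dots,G_n$, $A_1,\dots,A_n$, $A_{k_1},\dots,A_{k_m}$, $A_u$) if (1) for all $j=1,\dots,m$, $P_{k_j}(K')$ is controllable with respect to $L(G_{k_j})$ and $A_{k_j,u}$; and (2) for all $j=1,\dots,m$ and $i\in I_j$, $P_{i+k_j}(K')$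 is controllable with respect to $L(G_i)\parallel P_{k_j}(K')$ and $A_{i+k_j,u}$. $\sup\mathrm{2cC}(K,L,A_{i+k_j})$ denotes the largest two-level conditionally controllable sublanguage of $K$, which always exists (it is the union of all of them). A projection $Q:B^*\to C^*$, $C\subseteq B$, is an $L'$-observer for $L'\subseteq B^*$ if for every $t\in Q(L')$ and $s\in L'$ such that $Q(s)$ is a prefix of $t$ there is $u\in B^*$ with $su\in L'$ and $Q(su)=t$. It is OCC (output control consistent) for $L'$ if for every $s\in L'$ of the form $s=\sigma_1\cdots\sigma_\ell$ or $s=s'\sigma_0\sigma_1\cdots\sigma_\ell$ with $\ell\ge1$, $s'\in B^*$, $\sigma_0,\sigma_\ell\in C$ (only $\sigma_\ell\in C$ in the first form) and $\sigma_1,\dots,\sigma_{\ell-1}\in B\setminus C$: if $\sigma_\ell\in A_u$, then $\sigma_1,\dots,\sigma_{\ell-1}\in A_u$. *)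

theory Defs
  imports Main "HOL-Library.Sublist" "HOL-Library.FuncSet" "HOL-Library.Disjoint_Sets"
begin

section \<open>Languages, projections and synchronous products\<close>

definition prefix_closure :: "'a list set \<Rightarrow> 'a list set" where
  "prefix_closure L = {t. \<exists>s\<in>L. prefix t s}"

definition prefix_closed :: "'a list set \<Rightarrow> bool" where
  "prefix_closed L \<longleftrightarrow> L = prefix_closure L"

text \<open>Every projection onto the words over \<open>C\<close> is given by the same erasing function, restricted
  to the words over the alphabet on which it is considered.\<close>

definition proj :: "'a set \<Rightarrow> 'a list \<Rightarrow> 'a list" where
  "proj C s = filter (\<lambda>a. a \<in> C) s"

definition sync :: "'i set \<Rightarrow> ('i \<Rightarrow> 'a set) \<Rightarrow> ('i \<Rightarrow> 'a list set) \<Rightarrow> 'a list set" where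
  "sync J A L = {s \<in> lists (\<Union>i\<in>J. A i). \<forall>i\<in>J. proj (A i) s \<in> L i}"

definition sync2 :: "'a set \<Rightarrow> 'a list set \<Rightarrow> 'a set \<Rightarrow> 'a list set \<Rightarrow> 'a list set" where
  "sync2 A L B M = {s \<in> lists (A \<union> B). proj A s \<in> L \<and> proj B s \<in> M}"


section \<open>Generators\<close>

record ('q, 'a) generator =
  states :: "'q set"
  alphabet :: "'a set"
  trans :: "'q \<Rightarrow> 'a \<Rightarrow> 'q option"
  init :: 'q

definition wf_generator :: "('q, 'a) generator \<Rightarrow> bool" where
  "wf_generator G \<longleftrightarrow> finite (states G) \<and> finite (alphabet G) \<and> init G \<in> states G \<and>
     (\<forall>q a q'. trans G q a = Some q' \<longrightarrow> q \<in> states G \<and> a \<in> alphabet G \<and> q' \<in> states G)"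

fun run :: "('q, 'a) generator \<Rightarrow> 'q \<Rightarrow> 'a list \<Rightarrow> 'q option" where
  "run G q [] = Some q"
| "run G q (a # s) = Option.bind (trans G q a) (\<lambda>q'. run G q' s)"

definition lang :: "('q, 'a) generator \<Rightarrow> 'a list set" where
  "lang G = {s \<in> lists (alphabet G). \<exists>q\<in>states G. run G (init G) s = Some q}"

definition gen_sync :: "'i set \<Rightarrow> ('i \<Rightarrow> ('q, 'a) generator) \<Rightarrow> ('i \<Rightarrow> 'q, 'a) generator" where
  "gen_sync J G =
    \<lparr>states = (\<Pi>\<^sub>E i\<in>J. states (G i)),
     alphabet = (\<Union>i\<in>J. alphabet (G i)),
     trans = (\<lambda>q a.
       if q \<in> (\<Pi>\<^sub>E i\<in>J. states (G i)) \<and> a \<in> (\<Union>i\<in>J. alphabet (G i)) \<and>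
          (\<forall>i\<in>J. a \<in> alphabet (G i) \<longrightarrow> trans (G i) (q i) a \<noteq> None)
       then Some (\<lambda>i\<in>J. if a \<in> alphabet (G i) then the (trans (G i) (q i) a) else q i)
       else None),
     init = (\<lambda>i\<in>J. init (G i))\<rparr>"

text \<open>A projection of a generator is determined only up to its generated language, so it is a
  relation here; \<open>ex_proj_generator\<close> below shows that one always exists.\<close>

definition is_proj_generator ::
    "'a set \<Rightarrow> ('q, 'a) generator \<Rightarrow> ('p, 'a) generator \<Rightarrow> bool" where
  "is_proj_generator C H H' \<longleftrightarrow>
     wf_generator H' \<and> alphabet H' = alphabet H \<inter> C \<and> lang H' = proj C ` lang H"


section \<open>Controllability, observers and output control consistency\<close>

definition controllable :: "'a list set \<Rightarrow> 'a list set \<Rightarrow> 'a set \<Rightarrow> bool" where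
  "controllable K L Au \<longleftrightarrow> {s @ [a] | s a. s \<in> K \<and> a \<in> Au} \<inter> L \<subseteq> K"

definition supC :: "'a list set \<Rightarrow> 'a list set \<Rightarrow> 'a set \<Rightarrow> 'a list set" where
  "supC K L Au = \<Union> {M. M \<subseteq> K \<inter> L \<and> prefix_closed M \<and> controllable M L Au}"

definition observer :: "'a set \<Rightarrow> 'a set \<Rightarrow> 'a list set \<Rightarrow> bool" where
  "observer B C L \<longleftrightarrow>
     (\<forall>t \<in> proj C ` L. \<forall>s\<in>L. prefix (proj C s) t \<longrightarrow>
        (\<exists>u \<in> lists B. s @ u \<in> L \<and> proj C (s @ u) = t))"

text \<open>The list \<open>us\<close> consists of the letters \<open>\<sigma>\<^sub>1, \<dots>, \<sigma>\<^bsub>\<ell>-1\<^esub>\<close>, and \<open>b\<close> is \<open>\<sigma>\<^sub>\<ell>\<close>.\<close>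

definition occ :: "'a set \<Rightarrow> 'a set \<Rightarrow> 'a set \<Rightarrow> 'a list set \<Rightarrow> bool" where
  "occ B C Au L \<longleftrightarrow>
     (\<forall>s\<in>L. \<forall>us b.
        (s = us @ [b] \<or> (\<exists>s' \<in> lists B. \<exists>a\<in>C. s = s' @ [a] @ us @ [b])) \<and>
        set us \<subseteq> B - C \<and> b \<in> C \<and> b \<in> Au \<longrightarrow> set us \<subseteq> Au)"


section \<open>Two-level conditional decomposability and controllability\<close>

text \<open>Throughout, \<open>I j\<close> is the set of indices of the \<open>j\<close>-th group, \<open>Akg j\<close> is the alphabet
  \<open>A\<^bsub>k\<^sub>j\<^esub>\<close> of its coordinator, and \<open>Gkg j\<close> is the coordinator itself.\<close>

definition two_level_cond_decomposable ::
    "nat \<Rightarrow> (nat \<Rightarrow> nat set) \<Rightarrow> (nat \<Rightarrow> 'a set) \<Rightarrow> 'a set \<Rightarrow> (nat \<Rightarrow> 'a set) \<Rightarrow> 'a list set \<Rightarrow> bool" where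
  "two_level_cond_decomposable m I A Ak Akg K \<longleftrightarrow>
     K = sync {1..m} (\<lambda>r. (\<Union>i\<in>I r. A i) \<union> Ak) (\<lambda>r. proj ((\<Union>i\<in>I r. A i) \<union> Ak) ` K) \<and>
     (\<forall>r\<in>{1..m}. proj ((\<Union>i\<in>I r. A i) \<union> Ak) ` K =
        sync (I r) (\<lambda>i. A i \<union> Akg r) (\<lambda>i. proj (A i \<union> Akg r) ` K))"

definition two_level_cond_controllable ::
    "nat \<Rightarrow> nat \<Rightarrow> (nat \<Rightarrow> nat set) \<Rightarrow> (nat \<Rightarrow> ('q, 'a) generator) \<Rightarrow> (nat \<Rightarrow> 'a set) \<Rightarrow>
     (nat \<Rightarrow> ('p, 'a) generator) \<Rightarrow> (nat \<Rightarrow> 'a set) \<Rightarrow> 'a set \<Rightarrow> 'a list set \<Rightarrow> bool" where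
  "two_level_cond_controllable n m I G A Gkg Akg Au K \<longleftrightarrow>
     K \<subseteq> lang (gen_sync {1..n} G) \<and>
     (\<forall>j\<in>{1..m}. controllable (proj (Akg j) ` K) (lang (Gkg j)) (Akg j \<inter> Au)) \<and>
     (\<forall>j\<in>{1..m}. \<forall>i\<in>I j.
        controllable (proj (A i \<union> Akg j) ` K)
          (sync2 (A i) (lang (G i)) (Akg j) (proj (Akg j) ` K))
          ((A i \<union> Akg j) \<inter> Au))"

definition sup2cC ::
    "nat \<Rightarrow> nat \<Rightarrow> (nat \<Rightarrow> nat set) \<Rightarrow> (nat \<Rightarrow> ('q, 'a) generator) \<Rightarrow> (nat \<Rightarrow> 'a set) \<Rightarrow>
     (nat \<Rightarrow> ('p, 'a) generator) \<Rightarrow> (nat \<Rightarrow> 'a set) \<Rightarrow> 'a set \<Rightarrow> 'a list set \<Rightarrow> 'a list set" where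
  "sup2cC n m I G A Gkg Akg Au K =
     \<Union> {M. M \<subseteq> K \<and> prefix_closed M \<and> two_level_cond_controllable n m I G A Gkg Akg Au M}"


section \<open>Basic facts\<close>

lemma supC_greatest:
  shows supC_subset: "supC K L Au \<subseteq> K \<inter> L"
    and prefix_closed_supC: "prefix_closed (supC K L Au)"
    and controllable_supC: "controllable (supC K L Au) L Au"
    and supC_upper: "\<lbrakk>M \<subseteq> K \<inter> L; prefix_closed M; controllable M L Au\<rbrakk> \<Longrightarrow> M \<subseteq> supC K L Au"
proof -
  show "supC K L Au \<subseteq> K \<inter> L" by (auto simp: supC_def)
  show "prefix_closed (supC K L Au)"
    unfolding supC_def prefix_closed_def prefix_closure_def by blast
  show "controllable (supC K L Au) L Au"
    unfolding supC_def controllable_def by blast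
  show "M \<subseteq> supC K L Au" if "M \<subseteq> K \<inter> L" "prefix_closed M" "controllable M L Au"
    using that by (auto simp: supC_def)
qed

lemma run_append: "run G q (s @ t) = Option.bind (run G q s) (\<lambda>q'. run G q' t)"
  by (induction s arbitrary: q) (auto split: bind_splits)

lemma run_states:
  assumes "wf_generator G" "q \<in> states G" "run G q s = Some q'"
  shows "q' \<in> states G" and "s \<in> lists (alphabet G)"
proof -
  have step: "a \<in> alphabet G \<and> r' \<in> states G" if "trans G r a = Some r'" for r a r'
    using assms(1) that unfolding wf_generator_def by blast
  have "q' \<in> states G \<and> s \<in> lists (alphabet G)"
    using assms(2,3)
  proof (induction s arbitrary: q)
    case (Cons a s)
    then obtain r where r: "trans G q a = Some r" "run G r s = Some q'"
      by (auto simp: bind_eq_Some_conv)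
    then show ?case using Cons.IH[of r] step[OF r(1)] by simp
  qed simp
  then show "q' \<in> states G" "s \<in> lists (alphabet G)" by blast+
qed

lemma lang_iff:
  assumes "wf_generator G"
  shows "s \<in> lang G \<longleftrightarrow> run G (init G) s \<noteq> None"
  using assms run_states[OF assms, of "init G" s]
  by (auto simp: lang_def wf_generator_def)

lemma wf_gen_sync:
  assumes "finite J" "\<And>i. i \<in> J \<Longrightarrow> wf_generator (G i)"
  shows "wf_generator (gen_sync J G)"
proof -
  have "(\<lambda>i\<in>J. if a \<in> alphabet (G i) then the (trans (G i) (q i) a) else q i)
          \<in> (\<Pi>\<^sub>E i\<in>J. states (G i))"
    if "q \<in> (\<Pi>\<^sub>E i\<in>J. states (G i))"
      "\<forall>i\<in>J. a \<in> alphabet (G i) \<longrightarrow> trans (G i) (q i) a \<noteq> None" for q a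
  proof (rule restrict_PiE_iff[THEN iffD2], intro ballI)
    fix i assume i: "i \<in> J"
    show "(if a \<in> alphabet (G i) then the (trans (G i) (q i) a) else q i) \<in> states (G i)"
      using that i assms(2)[OF i] unfolding wf_generator_def
      by (metis PiE_mem option.collapse)
  qed
  then show ?thesis
    using assms unfolding wf_generator_def gen_sync_def
    by (auto intro!: finite_PiE split: if_splits)
qed

lemma run_gen_sync:
  assumes "\<And>i. i \<in> J \<Longrightarrow> wf_generator (G i)"
    and "q \<in> (\<Pi>\<^sub>E i\<in>J. states (G i))"
  shows "run (gen_sync J G) q s \<noteq> None \<longleftrightarrow>
     s \<in> lists (\<Union>i\<in>J. alphabet (G i)) \<and>
     (\<forall>i\<in>J. run (G i) (q i) (proj (alphabet (G i)) s) \<noteq> None)"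
  using assms(2)
proof (induction s arbitrary: q)
  case Nil
  then show ?case by (simp add: proj_def)
next
  case (Cons a s)
  define q' where "q' = (\<lambda>i\<in>J. if a \<in> alphabet (G i) then the (trans (G i) (q i) a) else q i)"
  show ?case
  proof (cases "a \<in> (\<Union>i\<in>J. alphabet (G i)) \<and>
          (\<forall>i\<in>J. a \<in> alphabet (G i) \<longrightarrow> trans (G i) (q i) a \<noteq> None)")
    case True
    have q': "q' \<in> (\<Pi>\<^sub>E i\<in>J. states (G i))"
      unfolding q'_def
    proof (rule restrict_PiE_iff[THEN iffD2], intro ballI)
      fix i assume i: "i \<in> J"
      show "(if a \<in> alphabet (G i) then the (trans (G i) (q i) a) else q i) \<in> states (G i)"
        using True Cons.prems i assms(1)[OF i] unfolding wf_generator_def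
        by (metis PiE_mem option.collapse)
    qed
    have "trans (gen_sync J G) q a = Some q'"
      using True Cons.prems by (simp add: gen_sync_def q'_def)
    then have "run (gen_sync J G) q (a # s) = run (gen_sync J G) q' s" by simp
    moreover have "run (G i) (q i) (proj (alphabet (G i)) (a # s)) =
        run (G i) (q' i) (proj (alphabet (G i)) s)" if "i \<in> J" for i
      using True that by (auto simp: proj_def q'_def)
    ultimately show ?thesis
      using Cons.IH[OF q'] True by simp
  next
    case False
    then have "trans (gen_sync J G) q a = None"
      by (auto simp: gen_sync_def)
    then have "run (gen_sync J G) q (a # s) = None" by simp
    moreover have "run (G i) (q i) (proj (alphabet (G i)) (a # s)) = None"
      if "a \<in> alphabet (G i)" "trans (G i) (q i) a = None" for i
      using that by (simp add: proj_def)
    ultimately show ?thesis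
      using False by (metis Cons_in_lists_iff)
  qed
qed

theorem lang_gen_sync:
  assumes "finite J" "\<And>i. i \<in> J \<Longrightarrow> wf_generator (G i)"
  shows "lang (gen_sync J G) = sync J (\<lambda>i. alphabet (G i)) (\<lambda>i. lang (G i))"
proof -
  have init: "(\<lambda>i\<in>J. init (G i)) \<in> (\<Pi>\<^sub>E i\<in>J. states (G i))"
    using assms(2) by (auto simp: wf_generator_def)
  have "init (gen_sync J G) = (\<lambda>i\<in>J. init (G i))" by (simp add: gen_sync_def)
  then have "s \<in> lang (gen_sync J G) \<longleftrightarrow> s \<in> sync J (\<lambda>i. alphabet (G i)) (\<lambda>i. lang (G i))" for s
    using run_gen_sync[OF assms(2) init, of s] assms(2)
    by (auto simp: lang_iff[OF wf_gen_sync[OF assms]] sync_def lang_iff)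
  then show ?thesis by blast
qed

lemma proj_snocE:
  assumes "proj C s = w @ [a]"
  obtains s1 s2 where "s = s1 @ s2" "proj C s1 = w" "proj C s2 = [a]"
proof -
  have "\<exists>s1 s2. s = s1 @ s2 \<and> proj C s1 = w \<and> proj C s2 = [a]"
    using assms
  proof (induction w arbitrary: s)
    case Nil
    then show ?case by (intro exI[of _ "[]"] exI[of _ s]) (simp add: proj_def)
  next
    case (Cons c w)
    then obtain us vs where "s = us @ c # vs" "\<forall>u\<in>set us. u \<notin> C" "c \<in> C" "proj C vs = w @ [a]"
      by (auto simp: proj_def filter_eq_Cons_iff)
    moreover from Cons.IH[OF this(4)] obtain s1 s2 where
      "vs = s1 @ s2" "proj C s1 = w" "proj C s2 = [a]" by blast
    ultimately show ?case
      by (intro exI[of _ "us @ c # s1"] exI[of _ s2]) (simp add: proj_def)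
  qed
  then show ?thesis using that by blast
qed

theorem ex_proj_generator:
  fixes H :: "('q, 'a) generator"
  assumes wf: "wf_generator H"
  shows "\<exists>H' :: ('q set, 'a) generator. is_proj_generator C H H'"
proof -
  define T where "T S a = {q'. \<exists>q\<in>S. \<exists>s. proj C s = [a] \<and> run H q s = Some q'}" for S a
  define R where "R w = {q. \<exists>s. proj C s = w \<and> run H (init H) s = Some q}" for w
  define H' :: "('q set, 'a) generator" where
    "H' = \<lparr>states = Pow (states H), alphabet = alphabet H \<inter> C,
           trans = (\<lambda>S a. if S \<subseteq> states H \<and> a \<in> alphabet H \<inter> C \<and> T S a \<noteq> {}
                          then Some (T S a) else None),
           init = R []\<rparr>"
  have i: "init H \<in> states H" using wf by (simp add: wf_generator_def)
  have R_sub: "R w \<subseteq> states H" for w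
    using run_states(1)[OF wf i] by (auto simp: R_def)
  have T_sub: "T S a \<subseteq> states H" if "S \<subseteq> states H" for S a
    using run_states(1)[OF wf] that by (fastforce simp: T_def)
  have T_R: "T (R w) a = R (w @ [a])" for w a
  proof
    show "T (R w) a \<subseteq> R (w @ [a])"
    proof
      fix q' assume "q' \<in> T (R w) a"
      then obtain q s t where "proj C t = w" "run H (init H) t = Some q"
        "proj C s = [a]" "run H q s = Some q'" by (auto simp: T_def R_def)
      then have "proj C (t @ s) = w @ [a] \<and> run H (init H) (t @ s) = Some q'"
        by (simp add: proj_def run_append)
      then show "q' \<in> R (w @ [a])" unfolding R_def by blast
    qed
    show "R (w @ [a]) \<subseteq> T (R w) a"
    proof
      fix q' assume "q' \<in> R (w @ [a])"
      then obtain s where s: "proj C s = w @ [a]" "run H (init H) s = Some q'"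
        by (auto simp: R_def)
      from s(1) obtain s1 s2 where "s = s1 @ s2" "proj C s1 = w" "proj C s2 = [a]"
        by (rule proj_snocE)
      with s(2) show "q' \<in> T (R w) a"
        by (fastforce simp: T_def R_def run_append bind_eq_Some_conv)
    qed
  qed
  have letter: "a \<in> alphabet H \<inter> C" if ne: "R (w @ [a]) \<noteq> {}" for w a
  proof -
    from ne obtain s q where s: "proj C s = w @ [a]" "run H (init H) s = Some q"
      by (auto simp: R_def)
    have "a \<in> set (proj C s)" using s(1) by simp
    then show ?thesis using run_states(2)[OF wf i s(2)] by (auto simp: proj_def)
  qed
  have wf': "wf_generator H'"
    using wf R_sub T_sub
    by (auto simp: wf_generator_def H'_def split: if_splits)
  have R_Nil: "R [] \<noteq> {}"
    unfolding R_def by (auto simp: proj_def intro!: exI[of _ "[]"])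
  have run': "run H' (R []) w = (if R w \<noteq> {} then Some (R w) else None)" for w
  proof (induction w rule: rev_induct)
    case Nil
    then show ?case using R_Nil by simp
  next
    case (snoc a w)
    have "R (w @ [a]) = {}" if "R w = {}"
      using that T_R[of w a] by (auto simp: T_def)
    then show ?case
      using snoc R_sub[of w] letter[of w a] by (auto simp: run_append H'_def T_R)
  qed
  have "lang H' = proj C ` lang H"
  proof -
    have "w \<in> lang H' \<longleftrightarrow> R w \<noteq> {}" for w
    proof -
      have "init H' = R []" by (simp add: H'_def)
      then show ?thesis using run'[of w] by (simp add: lang_iff[OF wf'])
    qed
    moreover have "R w \<noteq> {} \<longleftrightarrow> w \<in> proj C ` lang H" for w
      unfolding R_def image_iff Bex_def lang_iff[OF wf] by blast
    ultimately show ?thesis by blast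
  qed
  with wf' have "is_proj_generator C H H'"
    by (simp add: is_proj_generator_def H'_def)
  then show ?thesis by blast
qed

end

theory Submission
  imports Defs
begin

text \<open>Write \<open>C\<^sub>j\<close> for the intersection in hypothesis (i) and \<open>M\<close> for the right-hand side. All letters
  shared by two components lie in a coordinator alphabet, so words agreeing on the shared letters
  can be glued together; hence \<open>w \<in> P\<^bsub>k\<^sub>j\<^esub>(M)\<close> as soon as \<open>w \<in> C\<^sub>j\<close> and \<open>P\<^sub>k(w) \<in> P\<^sub>k(C\<^sub>l)\<close> for all \<open>l\<close>.
  If such a \<open>w\<close> is extended in \<open>L(G\<^bsub>k\<^sub>j\<^esub>)\<close> by an uncontrollable \<open>a\<close>, then \<open>wa \<in> C\<^sub>j \<subseteq> P\<^bsub>k\<^sub>j\<^esub>(K)\<close>. In general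
  \<open>P\<^sub>k(L(G\<^bsub>k\<^sub>j\<^esub>))\<close> is not contained in \<open>P\<^sub>k(L(G\<^bsub>k\<^sub>l\<^esub>))\<close>, but the passage through \<open>K\<close> gives
  \<open>P\<^sub>k(wa) \<in> P\<^sub>k(K) \<subseteq> P\<^sub>k(L(G\<^bsub>k\<^sub>l\<^esub>))\<close>, and \<open>P\<^sub>k(C\<^sub>l)\<close> is controllable with respect to the latter by the
  observer and OCC properties. So \<open>wa \<in> P\<^bsub>k\<^sub>j\<^esub>(M)\<close>.\<close>

section \<open>Projections and the gluing of words along shared letters\<close>

lemma proj_append [simp]: "proj C (s @ t) = proj C s @ proj C t"
  by (simp add: proj_def)

lemma proj_Nil [simp]: "proj C [] = []"
  by (simp add: proj_def)

lemma proj_Cons [simp]: "proj C (a # s) = (if a \<in> C then a # proj C s else proj C s)"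
  by (simp add: proj_def)

lemma proj_proj: "proj C (proj D s) = proj (C \<inter> D) s"
  by (simp add: proj_def conj_commute)

lemma proj_proj_subset: "C \<subseteq> D \<Longrightarrow> proj C (proj D s) = proj C s"
  by (simp add: proj_proj inf_absorb1)

lemma proj_in_lists: "s \<in> lists D \<Longrightarrow> proj C s \<in> lists (C \<inter> D)"
  by (auto simp: proj_def)

lemma proj_lists [simp]: "proj C s \<in> lists C"
  by (auto simp: proj_def)

lemma proj_ident: "s \<in> lists C \<Longrightarrow> proj C s = s"
  by (auto simp: proj_def filter_id_conv)

lemma proj_restrict:
  assumes "s \<in> lists B" "D \<inter> B = E \<inter> B"
  shows "proj D s = proj E s"
  using assms by (metis proj_ident proj_proj)

lemma proj_eq_Nil_iff: "proj C s = [] \<longleftrightarrow> set s \<inter> C = {}"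
  by (auto simp: proj_def filter_empty_conv)

text \<open>A head letter private to one of the two words can be emitted at once; if both heads are
  shared, the agreement of the projections forces them to be equal and they are emitted together.
  Each move shortens at least one word, hence the induction on the total length.\<close>

lemma proj_glue:
  assumes "v \<in> lists B" "w \<in> lists D" "proj D v = proj B w"
  shows "\<exists>z \<in> lists (B \<union> D). proj B z = v \<and> proj D z = w"
  using assms
proof (induction "length v + length w" arbitrary: v w rule: less_induct)
  case less
  show ?case
  proof (cases v)
    case Nil
    then show ?thesis
      using less.prems by (intro bexI[of _ w]) (auto simp: proj_ident)
  next
    case v: (Cons a v')
    show ?thesis
    proof (cases w)
      case Nil
      then show ?thesis
        using less.prems by (intro bexI[of _ v]) (auto simp: proj_ident simp del: proj_Cons)
    next
      case w: (Cons b w')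
      consider "a \<notin> D" | "b \<notin> B" | "a \<in> D" "b \<in> B" by blast
      then show ?thesis
      proof cases
        case 1
        with less.hyps[of v' w] less.prems obtain z where
          "z \<in> lists (B \<union> D)" "proj B z = v'" "proj D z = w"
          by (auto simp: v)
        then show ?thesis
          using 1 less.prems by (intro bexI[of _ "a # z"]) (auto simp: v)
      next
        case 2
        with less.hyps[of v w'] less.prems obtain z where
          "z \<in> lists (B \<union> D)" "proj B z = v" "proj D z = w'"
          by (auto simp: w simp del: proj_Cons) (auto simp: v w)
        then show ?thesis
          using 2 less.prems by (intro bexI[of _ "b # z"]) (auto simp: w)
      next
        case 3
        with less.hyps[of v' w'] less.prems obtain z where
          "z \<in> lists (B \<union> D)" "proj B z = v'" "proj D z = w'" "a = b"
          by (auto simp: v w)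
        then show ?thesis
          using 3 less.prems by (intro bexI[of _ "a # z"]) (auto simp: v w)
      qed
    qed
  qed
qed

text \<open>The words are glued one after the other with \<open>proj_glue\<close>: the alphabet used
  so far meets the next one exactly in \<open>C\<close>, so having the same projection
  \<open>c\<close> is all the agreement required. Carrying \<open>c\<close> as a word of its own
  makes the empty family a valid base case.\<close>

lemma proj_glue_family:
  assumes "finite J" "c \<in> lists C"
    and "\<And>i. i \<in> J \<Longrightarrow> C \<subseteq> B i" "\<And>i. i \<in> J \<Longrightarrow> v i \<in> lists (B i)"
    and "\<And>i. i \<in> J \<Longrightarrow> proj C (v i) = c"
    and "\<And>p q. \<lbrakk>p \<in> J; q \<in> J; p \<noteq> q\<rbrakk> \<Longrightarrow> B p \<inter> B q \<subseteq> C"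
  shows "\<exists>z \<in> lists (C \<union> (\<Union>i\<in>J. B i)). proj C z = c \<and> (\<forall>i\<in>J. proj (B i) z = v i)"
  using assms
proof (induction J rule: finite_induct)
  case empty
  then show ?case by (auto simp: proj_ident)
next
  case (insert x F)
  let ?D = "C \<union> (\<Union>i\<in>F. B i)"
  have "\<exists>z\<in>lists ?D. proj C z = c \<and> (\<forall>i\<in>F. proj (B i) z = v i)"
    by (rule insert.IH) (use insert.prems in auto)
  then obtain z where z: "z \<in> lists ?D" "proj C z = c" "\<forall>i\<in>F. proj (B i) z = v i" by blast
  have shared: "B x \<inter> ?D = C"
    using insert.prems(2)[of x] insert.prems(5)[of x] insert.hyps(2) by blast
  have vx: "v x \<in> lists (B x)" "proj C (v x) = c"
    using insert.prems by auto
  have "proj (B x) z = proj C z"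
    using shared by (intro proj_restrict[OF z(1)]) blast
  moreover have "proj ?D (v x) = proj C (v x)"
    using shared by (intro proj_restrict[OF vx(1)]) blast
  ultimately obtain y where y: "y \<in> lists (?D \<union> B x)" "proj ?D y = z" "proj (B x) y = v x"
    using proj_glue[OF z(1) vx(1)] z(2) vx(2) by auto
  have "proj C y = c"
    using y(2) z(2) proj_proj_subset[of C ?D y] by auto
  moreover have "proj (B i) y = v i" if "i \<in> F" for i
  proof -
    have "B i \<subseteq> ?D" using that by blast
    then show ?thesis using y(2) z(3) that by (metis proj_proj_subset)
  qed
  ultimately show ?case
    using y by (intro bexI[of _ y]) (auto simp: Un_ac)
qed

text \<open>Gluing gives the nontrivial inclusion. This turns the intersection in hypothesis (i)
  into the coordinator projection of a group product. A nonempty index set ensures that a word of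
  the intersection is over \<open>C\<close> and that \<open>C\<close> lies in the union of the
  alphabets.\<close>

lemma proj_sync_eq_Inter:
  assumes "finite J" "J \<noteq> {}"
    and "\<And>i. i \<in> J \<Longrightarrow> C \<subseteq> B i" "\<And>i. i \<in> J \<Longrightarrow> L i \<subseteq> lists (B i)"
    and "\<And>p q. \<lbrakk>p \<in> J; q \<in> J; p \<noteq> q\<rbrakk> \<Longrightarrow> B p \<inter> B q \<subseteq> C"
  shows "proj C ` sync J B L = (\<Inter>i\<in>J. proj C ` L i)"
proof
  show "proj C ` sync J B L \<subseteq> (\<Inter>i\<in>J. proj C ` L i)"
  proof (intro subsetI INT_I)
    fix w i assume "w \<in> proj C ` sync J B L" and i: "i \<in> J"
    then obtain s where s: "s \<in> sync J B L" "w = proj C s" by blast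
    then have "w = proj C (proj (B i) s)" by (simp add: proj_proj_subset assms(3) i)
    then show "w \<in> proj C ` L i" using s i by (auto simp: sync_def)
  qed
  show "(\<Inter>i\<in>J. proj C ` L i) \<subseteq> proj C ` sync J B L"
  proof
    fix w assume w: "w \<in> (\<Inter>i\<in>J. proj C ` L i)"
    then have "\<forall>i\<in>J. \<exists>s. s \<in> L i \<and> proj C s = w" by blast
    then obtain v where v: "\<And>i. i \<in> J \<Longrightarrow> v i \<in> L i \<and> proj C (v i) = w" by metis
    have "w \<in> lists C" using v assms(2) proj_lists by (metis ex_in_conv)
    then have "\<exists>z\<in>lists (C \<union> (\<Union>i\<in>J. B i)). proj C z = w \<and> (\<forall>i\<in>J. proj (B i) z = v i)"
    proof (rule proj_glue_family[OF assms(1)])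
      show "v i \<in> lists (B i)" if "i \<in> J" for i
        using v[OF that] assms(4)[OF that] by (meson subsetD)
    qed (use assms(3,5) v in simp_all)
    then obtain z where z: "z \<in> lists (C \<union> (\<Union>i\<in>J. B i))" "proj C z = w"
        "\<forall>i\<in>J. proj (B i) z = v i" by blast
    have "C \<union> (\<Union>i\<in>J. B i) = (\<Union>i\<in>J. B i)" using assms(2,3) by blast
    then show "w \<in> proj C ` sync J B L" using z v by (auto simp: sync_def)
  qed
qed

section \<open>Prefix closure and synchronous products\<close>

lemma prefix_closed_iff: "prefix_closed L \<longleftrightarrow> (\<forall>s t. s @ t \<in> L \<longrightarrow> s \<in> L)"
  unfolding prefix_closed_def prefix_closure_def
  by (auto simp: prefix_def)

lemma sync_cong:
  assumes "\<And>i. i \<in> J \<Longrightarrow> A i = A' i" "\<And>i. i \<in> J \<Longrightarrow> L i = L' i"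
  shows "sync J A L = sync J A' L'"
proof -
  have "(\<Union>i\<in>J. A i) = (\<Union>i\<in>J. A' i)" using assms(1) by (rule SUP_cong[OF refl])
  then show ?thesis using assms unfolding sync_def by simp
qed

lemma sync_mono:
  assumes "\<And>i. i \<in> J \<Longrightarrow> L i \<subseteq> L' i"
  shows "sync J A L \<subseteq> sync J A L'"
  using assms unfolding sync_def by blast

lemma prefix_closed_sync:
  assumes "\<And>i. i \<in> J \<Longrightarrow> prefix_closed (L i)"
  shows "prefix_closed (sync J A L)"
  unfolding prefix_closed_iff
proof (intro allI impI)
  fix s t assume st: "s @ t \<in> sync J A L"
  have "proj (A i) s \<in> L i" if "i \<in> J" for i
    using assms[OF that] st that unfolding prefix_closed_iff sync_def by auto
  then show "s \<in> sync J A L" using st unfolding sync_def by auto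
qed

lemma proj_eq_appendE:
  assumes "proj C x = s @ t"
  obtains y z where "x = y @ z" "proj C y = s"
proof -
  have "\<exists>y z. x = y @ z \<and> proj C y = s"
    using assms
  proof (induction x arbitrary: s)
    case Nil
    then show ?case by simp
  next
    case (Cons b x)
    show ?case
    proof (cases "s \<noteq> [] \<and> b \<in> C")
      case True
      then obtain u where "s = b # u" "proj C x = u @ t"
        using Cons.prems by (cases s) auto
      then show ?thesis
        using Cons.IH[of u] True by (metis append_Cons proj_Cons)
    next
      case False
      show ?thesis
      proof (cases "s = []")
        case True
        then show ?thesis by (metis append_Nil proj_Nil)
      next
        case s: False
        then show ?thesis
          using False Cons.IH[of s] Cons.prems by (metis append_Cons proj_Cons)
      qed
    qed
  qed
  then show ?thesis using that by blast
qed

lemma prefix_closed_proj: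
  assumes "prefix_closed L"
  shows "prefix_closed (proj C ` L)"
  unfolding prefix_closed_iff
proof (intro allI impI)
  fix s t assume "s @ t \<in> proj C ` L"
  then obtain x where x: "x \<in> L" "proj C x = s @ t" by auto
  from x(2) obtain y z where "x = y @ z" "proj C y = s" by (rule proj_eq_appendE)
  then show "s \<in> proj C ` L"
    using x(1) assms unfolding prefix_closed_iff by blast
qed

lemma prefix_closed_lang: "wf_generator H \<Longrightarrow> prefix_closed (lang H)"
  by (auto simp: prefix_closed_iff lang_iff run_append bind_eq_Some_conv)

section \<open>Controllability under projection\<close>

lemma controllableD:
  "\<lbrakk>controllable M L Au; s \<in> M; a \<in> Au; s @ [a] \<in> L\<rbrakk> \<Longrightarrow> s @ [a] \<in> M"
  by (auto simp: controllable_def)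

text \<open>Prefix closure of \<open>L\<close> puts every intermediate word into \<open>L\<close>,
  so controllability applies letter by letter.\<close>

lemma controllable_append:
  assumes "controllable M L Au" "prefix_closed L" "s \<in> M" "set t \<subseteq> Au" "s @ t \<in> L"
  shows "s @ t \<in> M"
  using assms(4,5)
proof (induction t rule: rev_induct)
  case Nil
  then show ?case using assms(3) by simp
next
  case (snoc a t)
  then have "s @ t \<in> L"
    using assms(2) unfolding prefix_closed_iff by (metis append_assoc)
  then show ?case
    using snoc controllableD[OF assms(1), of "s @ t" a] by simp
qed

text \<open>\<open>occ\<close> speaks of the whole block of erased letters before \<open>a\<close>,
  whereas \<open>v\<close> may be only its end. The block is completed backwards to the last letter
  of \<open>C\<close> in \<open>t\<close>, or to the beginning of the word if there is none; all of
  it is then uncontrollable, in particular \<open>v\<close>.\<close>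

lemma occD:
  assumes "occ B C Au L" "t @ v @ [a] \<in> L" "t @ v \<in> lists B"
    and "set v \<inter> C = {}" "a \<in> C \<inter> Au"
  shows "set v \<subseteq> Au"
proof (cases "set t \<inter> C = {}")
  case True
  then have "set (t @ v) \<subseteq> B - C" using assms(3,4) by auto
  moreover have "t @ v @ [a] = (t @ v) @ [a]" by simp
  ultimately have "set (t @ v) \<subseteq> Au"
    using assms(1,2,5) unfolding occ_def by (metis Int_iff)
  then show ?thesis by simp
next
  case False
  then obtain s b us where t: "t = s @ b # us" "b \<in> C" "\<forall>x\<in>set us. x \<notin> C"
    using split_list_last_prop[of t "\<lambda>x. x \<in> C"] by (auto simp: disjoint_iff)
  have "set (us @ v) \<subseteq> B - C" "s \<in> lists B"
    using assms(3,4) t by auto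
  moreover have "t @ v @ [a] = s @ [b] @ (us @ v) @ [a]" by (simp add: t)
  ultimately have "set (us @ v) \<subseteq> Au"
    using assms(1,2,5) t(2) unfolding occ_def by (metis Int_iff)
  then show ?thesis by simp
qed

text \<open>The observer property continues \<open>t\<close> inside \<open>L\<close> to a word with
  the prescribed projection, OCC makes the erased letters before \<open>a\<close> uncontrollable,
  and controllability of \<open>M\<close> then follows this continuation up to
  \<open>a\<close>.\<close>

lemma controllable_proj:
  assumes "observer B C L" "occ B C Au L" "prefix_closed L" "L \<subseteq> lists B"
    and "M \<subseteq> L" "controllable M L (B \<inter> Au)"
  shows "controllable (proj C ` M) (proj C ` L) (C \<inter> Au)"
  unfolding controllable_def
proof
  fix w
  assume "w \<in> {s @ [a] | s a. s \<in> proj C ` M \<and> a \<in> C \<inter> Au} \<inter> proj C ` L"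
  then obtain t a x where t: "t \<in> M" and a: "a \<in> C" "a \<in> Au"
    and x: "x \<in> L" "proj C t @ [a] = proj C x" and w: "w = proj C t @ [a]"
    by auto
  obtain v where v: "t @ v \<in> L" "proj C (t @ v) = proj C t @ [a]"
    using assms(1,5) t x unfolding observer_def by (metis imageI prefixI subsetD)
  then have "filter (\<lambda>c. c \<in> C) v = [a]" by (simp add: proj_def)
  then obtain v1 v2 where v12: "v = v1 @ a # v2" "\<forall>c\<in>set v1. c \<notin> C"
    by (auto simp: filter_eq_Cons_iff)
  \<comment> \<open>The erased tail \<open>v2\<close> may contain controllable letters, so it is cut
    off.\<close>
  have L: "t @ v1 @ [a] \<in> L"
    using v(1) assms(3) unfolding prefix_closed_iff v12(1)
    by (metis append.assoc append_Cons append_Nil)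
  then have B: "t @ v1 @ [a] \<in> lists B" using assms(4) by blast
  have "set v1 \<subseteq> Au"
    using occD[OF assms(2) L] B v12(2) a by auto
  then have "t @ v1 @ [a] \<in> M"
    using B a L by (intro controllable_append[OF assms(6,3) t]) auto
  moreover have "proj C (t @ v1 @ [a]) = proj C t @ [a]"
    using a v12(2) proj_eq_Nil_iff[of C v1] by auto
  ultimately show "w \<in> proj C ` M"
    unfolding w by (metis imageI)
qed

section \<open>The supremal two-level conditionally controllable sublanguage\<close>

theorem theorem14:
  fixes n m :: nat
    and I :: "nat \<Rightarrow> nat set"
    and G :: "nat \<Rightarrow> ('q, 'a) generator"
    and A :: "nat \<Rightarrow> 'a set"
    and Ac Au :: "'a set"
    and Ak :: "'a set" and Akg :: "nat \<Rightarrow> 'a set"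
    and PG :: "nat \<Rightarrow> nat \<Rightarrow> ('p, 'a) generator"
    and Gkg :: "nat \<Rightarrow> (nat \<Rightarrow> 'p, 'a) generator"
    and K :: "'a list set"
    and supCk :: "nat \<Rightarrow> 'a list set"
    and supCi :: "nat \<Rightarrow> nat \<Rightarrow> 'a list set"
  assumes generators: "\<And>i. i \<in> {1..n} \<Longrightarrow> wf_generator (G i) \<and> alphabet (G i) = A i"
    and events: "Ac \<subseteq> (\<Union>i\<in>{1..n}. A i)" "Au = (\<Union>i\<in>{1..n}. A i) - Ac"
    and groups: "(\<Union>j\<in>{1..m}. I j) = {1..n}" "disjoint_family_on I {1..m}"
      "\<And>j. j \<in> {1..m} \<Longrightarrow> I j \<noteq> {}"
    and Ak_sub: "Ak \<subseteq> (\<Union>i\<in>{1..n}. A i)"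
    and Ak_shared: "\<And>r l. \<lbrakk>r \<in> {1..m}; l \<in> {1..m}; r \<noteq> l\<rbrakk> \<Longrightarrow>
      (\<Union>i\<in>I r. A i) \<inter> (\<Union>i\<in>I l. A i) \<subseteq> Ak"
    and Akg_lower: "\<And>j. j \<in> {1..m} \<Longrightarrow>
      Ak \<union> (\<Union>p\<in>I j. \<Union>q\<in>I j - {p}. A p \<inter> A q) \<subseteq> Akg j"
    and Akg_upper: "\<And>j. j \<in> {1..m} \<Longrightarrow> Akg j \<subseteq> (\<Union>i\<in>I j. A i) \<union> Ak"
    and proj_generators: "\<And>j i. \<lbrakk>j \<in> {1..m}; i \<in> {1..n}\<rbrakk> \<Longrightarrow>
      is_proj_generator (Akg j) (G i) (PG j i)"
    and coordinators: "\<And>j. j \<in> {1..m} \<Longrightarrow> Gkg j = gen_sync {1..n} (PG j)"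
    and K: "prefix_closed K" "K \<subseteq> lang (gen_sync {1..n} G)"
      "two_level_cond_decomposable m I A Ak Akg K"
    and supCk: "\<And>j. j \<in> {1..m} \<Longrightarrow>
      supCk j = supC (proj (Akg j) ` K) (lang (Gkg j)) (Akg j \<inter> Au)"
    and supCi: "\<And>j i. \<lbrakk>j \<in> {1..m}; i \<in> I j\<rbrakk> \<Longrightarrow>
      supCi j i = supC (proj (A i \<union> Akg j) ` K)
        (sync2 (A i) (lang (G i)) (Akg j) (supCk j)) ((A i \<union> Akg j) \<inter> Au)"
    and inter_controllable: "\<And>j. j \<in> {1..m} \<Longrightarrow>
      controllable (\<Inter>i\<in>I j. proj (Akg j) ` supCi j i) (lang (Gkg j)) (Akg j \<inter> Au)"
    and observer_occ: "\<And>j. j \<in> {1..m} \<Longrightarrow>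
      observer (Akg j) Ak (lang (Gkg j)) \<and> occ (Akg j) Ak Au (lang (Gkg j))"
  shows "sup2cC n m I G A Gkg Akg Au K =
    sync {1..m} (\<lambda>j. \<Union>i\<in>I j. A i \<union> Akg j)
      (\<lambda>j. sync (I j) (\<lambda>i. A i \<union> Akg j) (\<lambda>i. supCi j i))"
proof -
  \<comment> \<open>\<open>B j i\<close> is the alphabet of component \<open>i\<close> with its
    coordinator, \<open>N j\<close> the product over group \<open>j\<close>, and \<open>M\<close>
    the right-hand side of the claim. \<open>D j\<close> is written as the union occurring in that
    product; \<open>D_eq\<close> identifies it with the group alphabet used in
    decomposability.\<close>
  define B where "B j i = A i \<union> Akg j" for j i
  define D where "D j = (\<Union>i\<in>I j. B j i)" for j
  define N where "N j = sync (I j) (B j) (supCi j)" for j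
  define M where "M = sync {1..m} D N"
  define C where "C j = (\<Inter>i\<in>I j. proj (Akg j) ` supCi j i)" for j
  define L where "L = lang (gen_sync {1..n} G)"

  have finI: "finite (I j)" if "j \<in> {1..m}" for j
    using groups(1) that by (metis UN_upper finite_atLeastAtMost finite_subset)
  have In: "i \<in> {1..n}" if "j \<in> {1..m}" "i \<in> I j" for i j
    using groups(1) that by blast
  have Ak_Akg: "Ak \<subseteq> Akg j" if "j \<in> {1..m}" for j
    using Akg_lower[OF that] by blast
  have D_eq: "D j = (\<Union>i\<in>I j. A i) \<union> Ak" if "j \<in> {1..m}" for j
    using Akg_upper[OF that] Ak_Akg[OF that] groups(3)[OF that] unfolding D_def B_def by blast
  have B_D: "B j i \<subseteq> D j" if "i \<in> I j" for i j
    using that unfolding D_def by blast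
  have Akg_D: "Akg j \<subseteq> D j" if "j \<in> {1..m}" for j
    using groups(3)[OF that] unfolding D_def B_def by blast
  \<comment> \<open>The conditions for gluing at the two levels: components of a group meet inside
    \<open>Akg j\<close>, and different groups meet inside \<open>Ak\<close>.\<close>
  have B_shared: "B j p \<inter> B j q \<subseteq> Akg j" if "j \<in> {1..m}" "p \<in> I j" "q \<in> I j" "p \<noteq> q" for j p q
    using Akg_lower[OF that(1)] that unfolding B_def by blast
  have D_shared: "D j \<inter> D l \<subseteq> Ak" if "j \<in> {1..m}" "l \<in> {1..m}" "j \<noteq> l" for j l
    using Ak_shared[OF that] unfolding D_eq[OF that(1)] D_eq[OF that(2)] by blast
  have D_all: "(\<Union>j\<in>{1..m}. D j) = (\<Union>i\<in>{1..n}. A i)"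
  proof
    show "(\<Union>j\<in>{1..m}. D j) \<subseteq> (\<Union>i\<in>{1..n}. A i)"
    proof (rule UN_least)
      fix j assume j: "j \<in> {1..m}"
      show "D j \<subseteq> (\<Union>i\<in>{1..n}. A i)"
        unfolding D_eq[OF j] using In[OF j] Ak_sub by blast
    qed
    show "(\<Union>i\<in>{1..n}. A i) \<subseteq> (\<Union>j\<in>{1..m}. D j)"
    proof (rule UN_least)
      fix i assume "i \<in> {1..n}"
      then obtain j where "j \<in> {1..m}" "i \<in> I j" using groups(1) by blast
      then show "A i \<subseteq> (\<Union>j\<in>{1..m}. D j)" using B_D[of i j] unfolding B_def by blast
    qed
  qed

  \<comment> \<open>Languages of the plant and of the coordinators\<close>
  have wfG: "wf_generator (G i)" and alphG: "alphabet (G i) = A i" if "i \<in> {1..n}" for i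
    using generators[OF that] by auto
  have L_eq: "L = sync {1..n} (\<lambda>i. alphabet (G i)) (\<lambda>i. lang (G i))"
    unfolding L_def by (rule lang_gen_sync) (use wfG in auto)
  have wfPG: "wf_generator (PG j i)" if "j \<in> {1..m}" "i \<in> {1..n}" for j i
    using proj_generators[OF that] by (simp add: is_proj_generator_def)
  have Gkg_eq: "lang (Gkg j) = sync {1..n} (\<lambda>i. alphabet (PG j i)) (\<lambda>i. lang (PG j i))"
    if "j \<in> {1..m}" for j
    unfolding coordinators[OF that] by (rule lang_gen_sync) (use wfPG that in auto)
  have alphPG: "alphabet (PG j i) = A i \<inter> Akg j" and langPG: "lang (PG j i) = proj (Akg j) ` lang (G i)"
    if "j \<in> {1..m}" "i \<in> {1..n}" for j i
    using proj_generators[OF that] alphG[OF that(2)] by (auto simp: is_proj_generator_def)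
  have L_lists: "L \<subseteq> lists (\<Union>i\<in>{1..n}. A i)"
    using alphG unfolding L_eq sync_def by fastforce
  have proj_L: "proj (A i) s \<in> lang (G i)" if "s \<in> L" "i \<in> {1..n}" for s i
    using that alphG[OF that(2)] unfolding L_eq sync_def by fastforce
  have Gkg_lists: "lang (Gkg j) \<subseteq> lists (Akg j)" if "j \<in> {1..m}" for j
    using alphPG[OF that] unfolding Gkg_eq[OF that] sync_def by auto
  have Gkg_closed: "prefix_closed (lang (Gkg j))" if "j \<in> {1..m}" for j
    unfolding Gkg_eq[OF that]
    by (intro prefix_closed_sync prefix_closed_lang) (use wfPG that in auto)
  have L_Gkg: "proj (Akg j) ` L \<subseteq> lang (Gkg j)" if j: "j \<in> {1..m}" for j
  proof
    fix w assume "w \<in> proj (Akg j) ` L"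
    then obtain s where s: "s \<in> L" "w = proj (Akg j) s" by blast
    have "w \<in> lists (Akg j \<inter> (\<Union>i\<in>{1..n}. A i))"
      unfolding s(2) by (rule proj_in_lists) (use s(1) L_lists in blast)
    then have "w \<in> lists (\<Union>i\<in>{1..n}. A i \<inter> Akg j)" by auto
    moreover have "proj (A i \<inter> Akg j) w \<in> proj (Akg j) ` lang (G i)" if i: "i \<in> {1..n}" for i
    proof -
      \<comment> \<open>The projections to \<open>A i\<close> and to \<open>Akg j\<close> commute,
        so this component of \<open>w\<close> comes from a word of
        \<open>lang (G i)\<close>.\<close>
      have "proj (A i \<inter> Akg j) w = proj (Akg j) (proj (A i) s)"
        by (simp add: s(2) proj_proj Int_ac)
      then show ?thesis using proj_L[OF s(1) i] by auto
    qed
    ultimately show "w \<in> lang (Gkg j)"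
      unfolding Gkg_eq[OF j] sync_def using alphPG[OF j] langPG[OF j] by auto
  qed

  \<comment> \<open>The component suprema and the languages \<open>C j\<close>\<close>
  have supCk_sub: "supCk j \<subseteq> lang (Gkg j)" if "j \<in> {1..m}" for j
    unfolding supCk[OF that] using supC_subset by fast
  have supCi_sub: "supCi j i \<subseteq> proj (B j i) ` K"
      "supCi j i \<subseteq> sync2 (A i) (lang (G i)) (Akg j) (supCk j)"
    and supCi_closed: "prefix_closed (supCi j i)"
    and supCi_controllable: "controllable (supCi j i)
        (sync2 (A i) (lang (G i)) (Akg j) (supCk j)) (B j i \<inter> Au)"
    if "j \<in> {1..m}" "i \<in> I j" for j i
  proof -
    note S = supCi[OF that, folded B_def]
    have "supCi j i \<subseteq> proj (B j i) ` K \<inter> sync2 (A i) (lang (G i)) (Akg j) (supCk j)"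
      unfolding S by (rule supC_subset)
    then show "supCi j i \<subseteq> proj (B j i) ` K"
      "supCi j i \<subseteq> sync2 (A i) (lang (G i)) (Akg j) (supCk j)" by simp_all
    show "prefix_closed (supCi j i)" unfolding S by (rule prefix_closed_supC)
    show "controllable (supCi j i)
        (sync2 (A i) (lang (G i)) (Akg j) (supCk j)) (B j i \<inter> Au)"
      unfolding S by (rule controllable_supC)
  qed
  have supCi_lists: "supCi j i \<subseteq> lists (B j i)" if "j \<in> {1..m}" "i \<in> I j" for j i
    using supCi_sub(1)[OF that] by (auto simp: proj_def)
  have supCi_supCk: "proj (Akg j) ` supCi j i \<subseteq> supCk j" if "j \<in> {1..m}" "i \<in> I j" for j i
    using supCi_sub(2)[OF that] unfolding sync2_def by blast

  have C_eq: "C j = proj (Akg j) ` N j" if j: "j \<in> {1..m}" for j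
    unfolding C_def N_def
    by (rule proj_sync_eq_Inter[symmetric])
      (fact finI[OF j] groups(3)[OF j] supCi_lists[OF j] B_shared[OF j] | simp add: B_def)+
  have C_K: "C j \<subseteq> proj (Akg j) ` K" if j: "j \<in> {1..m}" for j
  proof
    fix w assume "w \<in> C j"
    moreover obtain i where i: "i \<in> I j" using groups(3)[OF j] by blast
    ultimately obtain v where "v \<in> supCi j i" "w = proj (Akg j) v"
      unfolding C_def by (meson INT_E imageE)
    moreover from this(1) obtain x where "x \<in> K" "v = proj (B j i) x"
      using supCi_sub(1)[OF j i] by (meson imageE subsetD)
    ultimately show "w \<in> proj (Akg j) ` K"
      by (simp add: B_def proj_proj_subset)
  qed
  have C_Gkg: "C j \<subseteq> lang (Gkg j)" if "j \<in> {1..m}" for j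
    using C_K[OF that] L_Gkg[OF that] K(2) unfolding L_def by blast
  have C_controllable: "controllable (C j) (lang (Gkg j)) (Akg j \<inter> Au)" if "j \<in> {1..m}" for j
    using inter_controllable[OF that] unfolding C_def .
  \<comment> \<open>Hypothesis (ii) enters here: it transports controllability of \<open>C j\<close>
    to \<open>Ak\<close>, the alphabet through which the groups interact.\<close>
  have Ck_controllable: "controllable (proj Ak ` C j) (proj Ak ` lang (Gkg j)) (Ak \<inter> Au)"
    if "j \<in> {1..m}" for j
  proof -
    have "observer (Akg j) Ak (lang (Gkg j))" "occ (Akg j) Ak Au (lang (Gkg j))"
      using observer_occ[OF that] by auto
    then show ?thesis
      by (rule controllable_proj)
        (rule Gkg_closed Gkg_lists C_Gkg C_controllable, rule that)+
  qed

  \<comment> \<open>Membership in the product and in its projections\<close>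
  have M_N: "proj (D j) s \<in> N j" if "s \<in> M" "j \<in> {1..m}" for s j
    using that unfolding M_def sync_def by blast
  have M_supCi: "proj (B j i) s \<in> supCi j i" if "s \<in> M" "j \<in> {1..m}" "i \<in> I j" for s i j
    using M_N[OF that(1,2)] that(3) proj_proj_subset[OF B_D[OF that(3)], of s]
    unfolding N_def sync_def by auto
  have M_I: "s \<in> M" if s: "s \<in> lists (\<Union>j\<in>{1..m}. D j)"
      and sB: "\<And>j i. \<lbrakk>j \<in> {1..m}; i \<in> I j\<rbrakk> \<Longrightarrow> proj (B j i) s \<in> supCi j i" for s
  proof -
    have "proj (D j) s \<in> N j" if j: "j \<in> {1..m}" for j
    proof -
      have "proj (D j) s \<in> lists (\<Union>i\<in>I j. B j i)"
        unfolding D_def by (rule proj_lists)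
      moreover have "proj (B j i) (proj (D j) s) \<in> supCi j i" if i: "i \<in> I j" for i
        unfolding proj_proj_subset[OF B_D[OF i]] by (rule sB[OF j i])
      ultimately show ?thesis unfolding N_def sync_def by blast
    qed
    then show ?thesis using s unfolding M_def sync_def by blast
  qed
  have M_C: "proj (Akg j) s \<in> C j" if "s \<in> M" "j \<in> {1..m}" for s j
    unfolding C_eq[OF that(2)]
    using imageI[OF M_N[OF that], of "proj (Akg j)"]
    by (simp only: proj_proj_subset[OF Akg_D[OF that(2)]])
  have M_Ck: "proj Ak s \<in> proj Ak ` C j" if "s \<in> M" "j \<in> {1..m}" for s j
    using imageI[OF M_C[OF that], of "proj Ak"]
    by (simp only: proj_proj_subset[OF Ak_Akg[OF that(2)]])
  have proj_MI: "w \<in> proj (Akg j) ` M"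
    if j: "j \<in> {1..m}" and w: "w \<in> C j" and wl: "\<And>l. l \<in> {1..m} \<Longrightarrow> proj Ak w \<in> proj Ak ` C l"
    for j w
  proof -
    \<comment> \<open>The word chosen for group \<open>j\<close> has to project to \<open>w\<close>
      itself; those for the other groups only need to agree with \<open>w\<close> on
      \<open>Ak\<close>, along which all of them are glued.\<close>
    have "\<exists>y. y \<in> N l \<and> proj Ak y = proj Ak w \<and> (l = j \<longrightarrow> proj (Akg j) y = w)"
      if l: "l \<in> {1..m}" for l
    proof -
      obtain c where c: "c \<in> C l" "proj Ak c = proj Ak w" "l = j \<longrightarrow> c = w"
        using w wl[OF l] by (metis imageE)
      then obtain y where y: "y \<in> N l" "c = proj (Akg l) y"
        unfolding C_eq[OF l] by (meson imageE)
      then have "proj Ak y = proj Ak w"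
        using c(2) by (simp add: proj_proj_subset[OF Ak_Akg[OF l]])
      then show ?thesis using c(3) y by blast
    qed
    then obtain y where y: "\<And>l. l \<in> {1..m} \<Longrightarrow> y l \<in> N l \<and> proj Ak (y l) = proj Ak w"
      "proj (Akg j) (y j) = w"
      using j by metis
    have N_lists: "N l \<subseteq> lists (D l)" for l
      by (auto simp: N_def sync_def D_def)
    have "\<exists>z\<in>lists (Ak \<union> (\<Union>l\<in>{1..m}. D l)). proj Ak z = proj Ak w \<and>
        (\<forall>l\<in>{1..m}. proj (D l) z = y l)"
    proof (rule proj_glue_family)
      show "Ak \<subseteq> D l" if "l \<in> {1..m}" for l
        using D_eq[OF that] by blast
      show "y l \<in> lists (D l)" if "l \<in> {1..m}" for l
        using y(1)[OF that] N_lists by blast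
    qed (use y(1) D_shared in simp_all)
    then obtain z where z: "z \<in> lists (Ak \<union> (\<Union>l\<in>{1..m}. D l))"
      "\<forall>l\<in>{1..m}. proj (D l) z = y l" by blast
    have "Ak \<subseteq> (\<Union>l\<in>{1..m}. D l)" using j D_eq[OF j] by blast
    then have "z \<in> lists (\<Union>l\<in>{1..m}. D l)" using z(1) by (simp only: sup_absorb2)
    then have "z \<in> M" using z(2) y(1) unfolding M_def sync_def by simp
    moreover have "proj (Akg j) z = w"
      using z(2) y(2) j proj_proj_subset[OF Akg_D[OF j], of z] by simp
    ultimately show ?thesis by blast
  qed

  \<comment> \<open>The product is a sublanguage of K\<close>
  have "sync {1..m} D (\<lambda>j. proj (D j) ` K) = sync {1..m} (\<lambda>r. (\<Union>i\<in>I r. A i) \<union> Ak)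
      (\<lambda>r. proj ((\<Union>i\<in>I r. A i) \<union> Ak) ` K)"
    by (rule sync_cong) (simp_all add: D_eq)
  then have K_eq: "K = sync {1..m} D (\<lambda>j. proj (D j) ` K)"
    using K(3) unfolding two_level_cond_decomposable_def by argo
  have K_group: "proj (D j) ` K = sync (I j) (B j) (\<lambda>i. proj (B j i) ` K)" if "j \<in> {1..m}" for j
    using K(3) that unfolding two_level_cond_decomposable_def B_def D_eq[OF that] by blast
  \<comment> \<open>The inclusions of the \<open>supCi j i\<close> in projections of
    \<open>K\<close> lift through both levels of decomposability, first within a group by
    \<open>K_group\<close>, then across groups by \<open>K_eq\<close>.\<close>
  have "N j \<subseteq> proj (D j) ` K" if j: "j \<in> {1..m}" for j
    unfolding K_group[OF j] N_def sync_def using supCi_sub(1)[OF j] by blast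
  then have M_K: "M \<subseteq> K"
    unfolding M_def by (subst K_eq) (rule sync_mono)
  have M_closed: "prefix_closed M"
    unfolding M_def N_def by (intro prefix_closed_sync supCi_closed)

  \<comment> \<open>Controllability of the coordinator projections\<close>
  have coord: "controllable (proj (Akg j) ` M) (lang (Gkg j)) (Akg j \<inter> Au)"
    if j: "j \<in> {1..m}" for j
    unfolding controllable_def
  proof clarify
    fix s a
    assume s: "s \<in> M" and a: "a \<in> Akg j" "a \<in> Au" and sa: "proj (Akg j) s @ [a] \<in> lang (Gkg j)"
    let ?w = "proj (Akg j) s @ [a]"
    have w: "?w \<in> C j"
      using controllableD[OF C_controllable[OF j] M_C[OF s j]] a sa by blast
    have Ak_s: "proj Ak (proj (Akg j) s) = proj Ak s"
      using proj_proj_subset[OF Ak_Akg[OF j]] .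
    show "?w \<in> proj (Akg j) ` M"
    proof (rule proj_MI[OF j w])
      fix l assume l: "l \<in> {1..m}"
      show "proj Ak ?w \<in> proj Ak ` C l"
      \<comment> \<open>A letter outside \<open>Ak\<close> is erased, so what is known for
        \<open>s\<close> suffices; a letter of \<open>Ak\<close> has to be followed into group
        \<open>l\<close>.\<close>
      proof (cases "a \<in> Ak")
        case False
        then show ?thesis using M_Ck[OF s l] Ak_s by simp
      next
        case True
        obtain x where x: "x \<in> K" "?w = proj (Akg j) x" using w C_K[OF j] by blast
        have "proj Ak ?w = proj Ak x"
          unfolding x(2) by (rule proj_proj_subset[OF Ak_Akg[OF j]])
        also have "\<dots> = proj Ak (proj (Akg l) x)"
          by (rule proj_proj_subset[OF Ak_Akg[OF l], symmetric])
        finally have "proj Ak ?w \<in> proj Ak ` lang (Gkg l)"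
          using L_Gkg[OF l] x(1) K(2) unfolding L_def by blast
        then show ?thesis
          using controllableD[OF Ck_controllable[OF l] M_Ck[OF s l], of a] True a Ak_s by simp
      qed
    qed
  qed

  \<comment> \<open>Controllability of the component projections\<close>
  have comp: "controllable (proj (B j i) ` M)
      (sync2 (A i) (lang (G i)) (Akg j) (proj (Akg j) ` M)) (B j i \<inter> Au)"
    if j: "j \<in> {1..m}" and i: "i \<in> I j" for j i
    unfolding controllable_def
  proof clarify
    fix s a
    assume s: "s \<in> M" and a: "a \<in> B j i" "a \<in> Au"
      and sa: "proj (B j i) s @ [a] \<in> sync2 (A i) (lang (G i)) (Akg j) (proj (Akg j) ` M)"
    define w where "w = proj (B j i) s @ [a]"
    \<comment> \<open>Controllability of \<open>supCi j i\<close> is relative to the product with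
      \<open>supCk j\<close>, so the smaller coordinator language is enlarged first.\<close>
    have "proj (Akg j) ` M \<subseteq> supCk j"
      using M_C[OF _ j] supCi_supCk[OF j i] i unfolding C_def by blast
    then have "w \<in> sync2 (A i) (lang (G i)) (Akg j) (supCk j)"
      using sa unfolding w_def sync2_def by blast
    then have w: "w \<in> supCi j i"
      unfolding w_def using controllableD[OF supCi_controllable[OF j i] M_supCi[OF s j i]] a by blast
    \<comment> \<open>\<open>x\<close> agrees with \<open>w\<close> on \<open>Akg j\<close> but
      perhaps not on the other letters of \<open>A i\<close>. The word \<open>z\<close> built below
      therefore follows \<open>w\<close> on component \<open>i\<close> and \<open>x\<close> on all
      others.\<close>
    obtain x where x: "x \<in> M" "proj (Akg j) w = proj (Akg j) x"
      using sa unfolding w_def sync2_def by blast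
    \<comment> \<open>\<open>E\<close> contains the alphabets of all other components and meets
      \<open>B j i\<close> exactly in \<open>Akg j\<close>, so that \<open>w\<close> and the
      projection of \<open>x\<close> can be glued.\<close>
    define E where "E = Akg j \<union> (\<Union>p\<in>I j - {i}. A p) \<union> (\<Union>l\<in>{1..m} - {j}. D l)"
    have "A i \<inter> D l \<subseteq> Ak" if "l \<in> {1..m}" "l \<noteq> j" for l
      using D_shared[OF j, of l] that B_D[OF i] unfolding B_def by blast
    then have "A i \<inter> E \<subseteq> Akg j"
      using Akg_lower[OF j] i unfolding E_def by blast
    then have BE: "B j i \<inter> E = Akg j"
      unfolding B_def E_def by blast
    have "proj E w = proj (Akg j) w"
      by (rule proj_restrict[of _ "B j i"]) (use w supCi_lists[OF j i] BE in blast)+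
    moreover have "proj (B j i) (proj E x) = proj (Akg j) x"
      by (simp add: proj_proj BE)
    ultimately obtain z where z: "z \<in> lists (B j i \<union> E)" "proj (B j i) z = w" "proj E z = proj E x"
      using proj_glue[of w "B j i" "proj E x" E] w supCi_lists[OF j i] x(2) by auto
    have BE_all: "B j i \<union> E \<subseteq> (\<Union>l\<in>{1..m}. D l)"
      using B_D[of _ j] Akg_D[OF j] i j unfolding E_def B_def by blast
    have "z \<in> M"
    proof (rule M_I)
      show "z \<in> lists (\<Union>l\<in>{1..m}. D l)" using z(1) BE_all by auto
      fix l p assume l: "l \<in> {1..m}" and p: "p \<in> I l"
      show "proj (B l p) z \<in> supCi l p"
      proof (cases "l = j \<and> p = i")
        case True
        then show ?thesis using z(2) w by simp
      next
        case False
        then have "B l p \<subseteq> E"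
          using B_D[OF p] l p unfolding E_def B_def by blast
        then have "proj (B l p) z = proj (B l p) x"
          using z(3) by (metis proj_proj_subset)
        then show ?thesis using M_supCi[OF x(1) l p] by simp
      qed
    qed
    then show "proj (B j i) s @ [a] \<in> proj (B j i) ` M"
      using z(2) unfolding w_def by (metis imageI)
  qed

  have "two_level_cond_controllable n m I G A Gkg Akg Au M"
    using M_K K(2) coord comp unfolding two_level_cond_controllable_def B_def by blast
  then have lower: "M \<subseteq> sup2cC n m I G A Gkg Akg Au K"
    using M_K M_closed unfolding sup2cC_def by blast

  \<comment> \<open>Maximality of the product\<close>
  have upper: "K' \<subseteq> M"
    if K': "K' \<subseteq> K" "prefix_closed K'" "two_level_cond_controllable n m I G A Gkg Akg Au K'" for K'
  proof
    fix s assume s: "s \<in> K'"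
    have K'_L: "K' \<subseteq> L" using K'(1) K(2) unfolding L_def by blast
    show "s \<in> M"
    proof (rule M_I)
      show "s \<in> lists (\<Union>j\<in>{1..m}. D j)"
        unfolding D_all using s K'_L L_lists by blast
      fix j i assume j: "j \<in> {1..m}" and i: "i \<in> I j"
      have cont_k: "controllable (proj (Akg j) ` K') (lang (Gkg j)) (Akg j \<inter> Au)"
        and cont_i: "controllable (proj (B j i) ` K')
          (sync2 (A i) (lang (G i)) (Akg j) (proj (Akg j) ` K')) (B j i \<inter> Au)"
        using K'(3) i j unfolding two_level_cond_controllable_def B_def by blast+
      have K'_supCk: "proj (Akg j) ` K' \<subseteq> supCk j"
        unfolding supCk[OF j]
        by (rule supC_upper) (use K'(1) K'_L L_Gkg[OF j] prefix_closed_proj[OF K'(2)] cont_k in blast)+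
      have "proj (B j i) ` K' \<subseteq> supCi j i"
        unfolding supCi[OF j i] B_def[symmetric]
      proof (rule supC_upper)
        show "prefix_closed (proj (B j i) ` K')" using prefix_closed_proj[OF K'(2)] .
        have "proj (B j i) t \<in> sync2 (A i) (lang (G i)) (Akg j) (supCk j)" if "t \<in> K'" for t
        proof -
          have "proj (A i) (proj (B j i) t) = proj (A i) t"
            "proj (Akg j) (proj (B j i) t) = proj (Akg j) t"
            by (simp_all add: B_def proj_proj_subset)
          moreover have "proj (B j i) t \<in> lists (A i \<union> Akg j)" unfolding B_def by simp
          ultimately show ?thesis
            using that K'_L proj_L In[OF j i] K'_supCk unfolding sync2_def by auto
        qed
        then show "proj (B j i) ` K' \<subseteq>
            proj (B j i) ` K \<inter> sync2 (A i) (lang (G i)) (Akg j) (supCk j)"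
          using K'(1) by blast
        \<comment> \<open>The assumption on \<open>K'\<close> concerns only the product with the
          projection of \<open>K'\<close>, which is contained in \<open>supCk j\<close>. An
          uncontrollable extension allowed by \<open>supCk j\<close> is in
          \<open>lang (Gkg j)\<close>, so controllability at the coordinator brings it back into the
          projection of \<open>K'\<close>.\<close>
        show "controllable (proj (B j i) ` K')
            (sync2 (A i) (lang (G i)) (Akg j) (supCk j)) (B j i \<inter> Au)"
          unfolding controllable_def
        proof clarify
          fix t a
          assume t: "t \<in> K'" and a: "a \<in> B j i" "a \<in> Au"
            and ta: "proj (B j i) t @ [a] \<in> sync2 (A i) (lang (G i)) (Akg j) (supCk j)"
          let ?w = "proj (B j i) t @ [a]"
          have w_k: "proj (Akg j) ?w = proj (Akg j) t @ proj (Akg j) [a]"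
            by (simp add: B_def proj_proj_subset)
          have w_Gkg: "proj (Akg j) ?w \<in> lang (Gkg j)"
            using ta supCk_sub[OF j] unfolding sync2_def by blast
          have "proj (Akg j) ?w \<in> proj (Akg j) ` K'"
          proof (cases "a \<in> Akg j")
            case True
            then show ?thesis
              using controllableD[OF cont_k, of "proj (Akg j) t" a] t a w_Gkg w_k by simp
          next
            case False
            then show ?thesis using t w_k by simp
          qed
          then have "?w \<in> sync2 (A i) (lang (G i)) (Akg j) (proj (Akg j) ` K')"
            using ta unfolding sync2_def by blast
          then show "?w \<in> proj (B j i) ` K'"
            using controllableD[OF cont_i] t a by blast
        qed
      qed
      then show "proj (B j i) s \<in> supCi j i" using s by blast
    qed
  qed
  have "sup2cC n m I G A Gkg Akg Au K = M"
    using lower upper unfolding sup2cC_def by blast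
  then show ?thesis unfolding M_def D_def N_def B_def .
qed

end
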